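(* Checking minimum (respectively maximum) aggregation of a distributed sequence of $n$ (key, value) pairs is possible in time $O(n/p + \alpha \log p)$, provided that the asserted output (one minimum (maximum) value per key) and a certificate specifying, for every key, which PE holds the minimum (maximum) element for that key are available at all PEs.
   Context: Distributed model: $p$ processing elements (PEs) connected by a network with full-duplex, single-ported communication; sending a message of $m$ bits costs time $\alpha+\beta m$; $\alpha,\beta$ treated as variables in asymptotic analysis. The input is distributed so that each PE holds $O(n/p)$ pairs; values are totally ordered. Minimum aggregation outputs, for each key occurring in the input, the minimum value associated with that key (maximum analogously). Checking means: always accept a correct asserted output, and reject any incorrect one.
   Formalization: The startup time α is assumed to be at least one local instruction (for α → 0 the bound fails, e.g. n = p, α = 1/log p), the time bound is for n > 0, and the certificate is stored with keys grouped by the PE they name, plus offsets. *)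

theory Defs
  imports Complex_Main
begin

text \<open>
  Machine model.  Each PE is a unit-cost random access machine whose cells hold natural numbers,
  keys or values.  Keys can only be tested for equality and used as array indices, values can only
  be compared.  Arrays are indexed by arbitrary cells, so an array indexed by keys is a lookup
  table with constant access time (direct addressing, or an idealised hash table).
\<close>

datatype ('k, 'v) cell = Undef | Num nat | Key 'k | Val 'v

datatype instr =
    Const nat nat           \<comment> \<open>register, number\<close>
  | Move nat nat            \<comment> \<open>target, source\<close>
  | Add nat nat nat         \<comment> \<open>target, two operands\<close>
  | Sub nat nat nat         \<comment> \<open>target, two operands; truncated\<close>
  | Load nat nat nat        \<comment> \<open>target, array, index register\<close>
  | Store nat nat nat       \<comment> \<open>array, index register, source\<close>
  | Jump nat                \<comment> \<open>address\<close>
  | Jump_Eq nat nat nat     \<comment> \<open>two operands, address\<close>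
  | Jump_Less nat nat nat   \<comment> \<open>two operands, address\<close>
  | Exchange nat nat nat nat
      \<comment> \<open>registers: destination PE, content, length in bits of the outgoing message; target of the
         incoming message\<close>
  | Halt bool               \<comment> \<open>verdict: accept or reject\<close>

record ('k, 'v) pe =
  pc :: nat
  reg :: "nat \<Rightarrow> ('k, 'v) cell"
  arr :: "nat \<Rightarrow> ('k, 'v) cell \<Rightarrow> ('k, 'v) cell"

fun num :: "('k, 'v) cell \<Rightarrow> nat" where
  "num (Num n) = n"
| "num _ = 0"

fun cell_less :: "('k, 'v::linorder) cell \<Rightarrow> ('k, 'v) cell \<Rightarrow> bool" where
  "cell_less (Num m) (Num n) = (m < n)"
| "cell_less (Val v) (Val w) = (v < w)"
| "cell_less _ _ = False"

definition set_reg :: "nat \<Rightarrow> ('k, 'v) cell \<Rightarrow> ('k, 'v) pe \<Rightarrow> ('k, 'v) pe" where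
  "set_reg r w s = s\<lparr>pc := Suc (pc s), reg := (reg s)(r := w)\<rparr>"

definition jump_if :: "bool \<Rightarrow> nat \<Rightarrow> ('k, 'v) pe \<Rightarrow> ('k, 'v) pe" where
  "jump_if b a s = s\<lparr>pc := (if b then a else Suc (pc s))\<rparr>"

fun exec :: "instr \<Rightarrow> ('k, 'v::linorder) pe \<Rightarrow> ('k, 'v) pe option" where
  "exec (Const r n) s = Some (set_reg r (Num n) s)"
| "exec (Move r x) s = Some (set_reg r (reg s x) s)"
| "exec (Add r x y) s = Some (set_reg r (Num (num (reg s x) + num (reg s y))) s)"
| "exec (Sub r x y) s = Some (set_reg r (Num (num (reg s x) - num (reg s y))) s)"
| "exec (Load r a x) s = Some (set_reg r (arr s a (reg s x)) s)"
| "exec (Store a x y) s =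
     Some (s\<lparr>pc := Suc (pc s), arr := (arr s)(a := (arr s a)(reg s x := reg s y))\<rparr>)"
| "exec (Jump a) s = Some (jump_if True a s)"
| "exec (Jump_Eq x y a) s = Some (jump_if (reg s x = reg s y) a s)"
| "exec (Jump_Less x y a) s = Some (jump_if (cell_less (reg s x) (reg s y)) a s)"
| "exec (Exchange d x l r) s = None"
| "exec (Halt b) s = None"

text \<open>
  Local computation up to the next \<^const>\<open>Exchange\<close> or \<^const>\<open>Halt\<close>, with the number of executed
  instructions.  A program counter outside the program is a fault: there is no such computation.
\<close>

inductive local_run ::
    "instr list \<Rightarrow> ('k, 'v::linorder) pe \<Rightarrow> nat \<Rightarrow> ('k, 'v) pe \<Rightarrow> bool" for P where
  stop: "pc s < length P \<Longrightarrow> exec (P ! pc s) s = None \<Longrightarrow> local_run P s 0 s"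
| step: "pc s < length P \<Longrightarrow> exec (P ! pc s) s = Some s' \<Longrightarrow> local_run P s' t s'' \<Longrightarrow>
    local_run P s (Suc t) s''"

text \<open>
  The message (destination, length in bits, content) issued by a PE that has reached an
  \<^const>\<open>Exchange\<close>.  A message of \<open>l\<close> bits is a number below \<open>2 ^ l\<close>; a destination register that
  does not hold the number of a PE means that nothing is sent.
\<close>

definition outgoing :: "instr list \<Rightarrow> nat \<Rightarrow> ('k, 'v) pe \<Rightarrow> (nat \<times> nat \<times> nat) option" where
  "outgoing P p s =
    (case P ! pc s of
       Exchange d x l r \<Rightarrow>
         (case reg s d of
            Num q \<Rightarrow> if q < p then Some (q, num (reg s l), num (reg s x) mod 2 ^ num (reg s l)) else None
          | _ \<Rightarrow> None)
     | _ \<Rightarrow> None)"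

text \<open>
  In one communication round every PE sends at most one message, and at the same time (full
  duplex) receives at most one message (single-ported).
\<close>

definition single_ported :: "instr list \<Rightarrow> nat \<Rightarrow> (nat \<Rightarrow> ('k, 'v) pe) \<Rightarrow> bool" where
  "single_ported P p S \<longleftrightarrow>
    (\<forall>i<p. \<forall>j<p. \<forall>q l x l' x'.
       outgoing P p (S i) = Some (q, l, x) \<longrightarrow> outgoing P p (S j) = Some (q, l', x') \<longrightarrow> i = j)"

definition incoming :: "instr list \<Rightarrow> nat \<Rightarrow> (nat \<Rightarrow> ('k, 'v) pe) \<Rightarrow> nat \<Rightarrow> ('k, 'v) cell" where
  "incoming P p S q =
    (if \<exists>i<p. \<exists>l x. outgoing P p (S i) = Some (q, l, x)
     then Num (THE x. \<exists>i<p. \<exists>l. outgoing P p (S i) = Some (q, l, x))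
     else Undef)"

definition deliver ::
    "instr list \<Rightarrow> nat \<Rightarrow> (nat \<Rightarrow> ('k, 'v) pe) \<Rightarrow> nat \<Rightarrow> ('k, 'v) pe" where
  "deliver P p S q =
    (case P ! pc (S q) of
       Exchange d x l r \<Rightarrow> set_reg r (incoming P p S q) (S q)
     | _ \<Rightarrow> S q)"

definition max_message_length :: "instr list \<Rightarrow> nat \<Rightarrow> (nat \<Rightarrow> ('k, 'v) pe) \<Rightarrow> nat" where
  "max_message_length P p S =
    Max (insert 0 {l. \<exists>i<p. \<exists>q x. outgoing P p (S i) = Some (q, l, x)})"

text \<open>
  Synchronous execution of one program on the PEs \<open>0, \<dots>, p - 1\<close>: phases of local computation
  alternate with communication rounds.  A phase lasts as long as its slowest PE, a round as long
  as its longest message.  The startup time \<open>\<alpha>\<close> is charged for every round, even if some or all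
  PEs stay silent in it.  The last two arguments are the total time and the verdicts of the PEs.
\<close>

inductive run :: "instr list \<Rightarrow> nat \<Rightarrow> real \<Rightarrow> real \<Rightarrow>
    (nat \<Rightarrow> ('k, 'v::linorder) pe) \<Rightarrow> real \<Rightarrow> (nat \<Rightarrow> bool) \<Rightarrow> bool"
  for P p \<alpha> \<beta> where
  halt: "(\<And>j. j < p \<Longrightarrow> local_run P (S j) (t j) (S' j)) \<Longrightarrow>
    (\<And>j. j < p \<Longrightarrow> P ! pc (S' j) = Halt (v j)) \<Longrightarrow>
    run P p \<alpha> \<beta> S (real (Max (t ` {..<p}))) v"
| round: "(\<And>j. j < p \<Longrightarrow> local_run P (S j) (t j) (S' j)) \<Longrightarrow>
    (\<And>j. j < p \<Longrightarrow> \<exists>d x l r. P ! pc (S' j) = Exchange d x l r) \<Longrightarrow>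
    single_ported P p S' \<Longrightarrow>
    run P p \<alpha> \<beta> (deliver P p S') T v \<Longrightarrow>
    run P p \<alpha> \<beta> S
      (real (Max (t ` {..<p})) + (\<alpha> + \<beta> * real (max_message_length P p S')) + T) v"

text \<open>
  The aggregation problem.  The input sequence is the concatenation of the local sequences
  \<open>xs 0, \<dots>, xs (p - 1)\<close>; \<open>agg\<close> is \<^const>\<open>Min\<close> or \<^const>\<open>Max\<close>.
\<close>

definition whole_input :: "nat \<Rightarrow> (nat \<Rightarrow> ('k \<times> 'v) list) \<Rightarrow> ('k \<times> 'v) list" where
  "whole_input p xs = concat (map xs [0..<p])"

definition aggregate :: "('v set \<Rightarrow> 'v) \<Rightarrow> ('k \<times> 'v) list \<Rightarrow> 'k \<rightharpoonup> 'v" where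
  "aggregate agg zs k =
    (if k \<in> fst ` set zs then Some (agg {v. (k, v) \<in> set zs}) else None)"

definition valid_certificate ::
    "('v set \<Rightarrow> 'v) \<Rightarrow> nat \<Rightarrow> (nat \<Rightarrow> ('k \<times> 'v) list) \<Rightarrow> ('k \<rightharpoonup> nat) \<Rightarrow> bool" where
  "valid_certificate agg p xs cert \<longleftrightarrow>
    (\<forall>k v. aggregate agg (whole_input p xs) k = Some v \<longrightarrow>
      (\<exists>j<p. cert k = Some j \<and> (k, v) \<in> set (xs j)))"

text \<open>
  An asserted output and a purported certificate, both arbitrary apart from their format: every
  key of the output is mapped to some PE.  The list \<open>ks\<close> is the order in which the keys of the
  output are stored, namely grouped by the PE that the certificate names.
\<close>

definition well_formed :: "nat \<Rightarrow> ('k \<rightharpoonup> 'v) \<Rightarrow> ('k \<rightharpoonup> nat) \<Rightarrow> 'k list \<Rightarrow> bool" where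
  "well_formed p out cert ks \<longleftrightarrow>
    dom cert = dom out \<and> ran cert \<subseteq> {..<p} \<and>
    set ks = dom out \<and> distinct ks \<and> sorted (map (\<lambda>k. the (cert k)) ks)"

text \<open>
  Initial memory of PE \<open>j\<close>.  Only the number \<open>j\<close> in register 1, the length of the local input in
  register 2 and the local input itself in arrays 0 (keys) and 1 (values) differ between PEs.  The
  output and the certificate are lookup tables in arrays 2 and 3.  Array 4 lists the keys of the
  output; those assigned to PE \<open>q\<close> occupy the positions from \<open>offset cert q\<close> up to, but excluding,
  \<open>offset cert (Suc q)\<close>, and array 5 holds these offsets.
\<close>

definition offset :: "('k \<rightharpoonup> nat) \<Rightarrow> nat \<Rightarrow> nat" where
  "offset cert q = card {k. \<exists>r<q. cert k = Some r}"

definition input_cell :: "(('k \<times> 'v) \<Rightarrow> ('k, 'v) cell) \<Rightarrow> ('k \<times> 'v) list \<Rightarrow>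
    ('k, 'v) cell \<Rightarrow> ('k, 'v) cell" where
  "input_cell f zs w = (case w of Num i \<Rightarrow> if i < length zs then f (zs ! i) else Undef | _ \<Rightarrow> Undef)"

definition table_cell :: "('a \<Rightarrow> ('k, 'v) cell) \<Rightarrow> ('k \<rightharpoonup> 'a) \<Rightarrow>
    ('k, 'v) cell \<Rightarrow> ('k, 'v) cell" where
  "table_cell f m w =
    (case w of Key k \<Rightarrow> (case m k of Some a \<Rightarrow> f a | None \<Rightarrow> Undef) | _ \<Rightarrow> Undef)"

definition keys_cell :: "'k list \<Rightarrow> ('k, 'v) cell \<Rightarrow> ('k, 'v) cell" where
  "keys_cell ks w = (case w of Num i \<Rightarrow> if i < length ks then Key (ks ! i) else Undef | _ \<Rightarrow> Undef)"

definition offset_cell :: "nat \<Rightarrow> ('k \<rightharpoonup> nat) \<Rightarrow> ('k, 'v) cell \<Rightarrow> ('k, 'v) cell" where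
  "offset_cell p cert w =
    (case w of Num q \<Rightarrow> if q \<le> p then Num (offset cert q) else Undef | _ \<Rightarrow> Undef)"

definition initial :: "nat \<Rightarrow> (nat \<Rightarrow> ('k \<times> 'v) list) \<Rightarrow> ('k \<rightharpoonup> 'v) \<Rightarrow> ('k \<rightharpoonup> nat) \<Rightarrow> 'k list \<Rightarrow>
    nat \<Rightarrow> ('k, 'v) pe" where
  "initial p xs out cert ks j =
    \<lparr>pc = 0,
     reg = (\<lambda>_. Undef)(0 := Num p, 1 := Num j, 2 := Num (length (xs j))),
     arr = (\<lambda>_ _. Undef)
       (0 := input_cell (\<lambda>z. Key (fst z)) (xs j),
        1 := input_cell (\<lambda>z. Val (snd z)) (xs j),
        2 := table_cell Val out,
        3 := table_cell Num cert,
        4 := keys_cell ks,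
        5 := offset_cell p cert)\<rparr>"

text \<open>The execution model is deterministic.\<close>

lemma local_run_unique:
  "local_run P s t u \<Longrightarrow> local_run P s t' u' \<Longrightarrow> t' = t \<and> u' = u"
proof (induction arbitrary: t' rule: local_run.induct)
  case (stop s)
  from stop(3) stop(1,2) show ?case by (cases rule: local_run.cases) auto
next
  case (step s s' t s'')
  from step.prems step.hyps step.IH show ?case by (cases rule: local_run.cases) auto
qed

lemma run_unique:
  assumes "run P p \<alpha> \<beta> S T v" "run P p \<alpha> \<beta> S' T' v'" "0 < p" "\<And>j. j < p \<Longrightarrow> S' j = S j"
  shows "T' = T \<and> (\<forall>j<p. v' j = v j)"
  using assms
proof (induction arbitrary: S' T' rule: run.induct)
  case (halt S t U v)
  from halt.prems(1) show ?case
  proof (cases rule: run.cases)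
    case (halt t' U')
    have eq: "t' j = t j \<and> U' j = U j" if "j < p" for j
      using local_run_unique halt(2) halt.hyps(1) halt.prems(3) that by metis
    then have "t' ` {..<p} = t ` {..<p}" by (intro image_cong) auto
    moreover have "v' j = v j" if "j < p" for j
      using halt(3)[OF that] halt.hyps(2)[OF that] eq[OF that] by simp
    ultimately show ?thesis using halt(1) by simp
  next
    case (round t' U' T0)
    have "U' 0 = U 0"
      using local_run_unique round(2) halt.hyps(1) halt.prems(2,3) by metis
    then show ?thesis using round(3)[OF halt.prems(2)] halt.hyps(2)[OF halt.prems(2)] by auto
  qed
next
  case (round S t U T v)
  from round.prems(1) show ?case
  proof (cases rule: run.cases)
    case (halt t' U')
    have "U' 0 = U 0"
      using local_run_unique halt(2) round.hyps(1) round.prems(2,3) by metis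
    then show ?thesis using halt(3)[OF round.prems(2)] round.hyps(2)[OF round.prems(2)] by auto
  next
    case (round t' U' T0)
    have eq: "t' j = t j \<and> U' j = U j" if "j < p" for j
      using local_run_unique round(2) round.hyps(1) round.prems(3) that by metis
    then have 1: "t' ` {..<p} = t ` {..<p}" by (intro image_cong) auto
    have out: "(\<exists>i<p. Q (outgoing P p (U' i))) = (\<exists>i<p. Q (outgoing P p (U i)))" for Q
      using eq by metis
    have 2: "max_message_length P p U' = max_message_length P p U"
      unfolding max_message_length_def
      using out[of "\<lambda>m. \<exists>q x. m = Some (q, l, x)" for l] by simp
    have "incoming P p U' q = incoming P p U q" for q
      unfolding incoming_def
      using out[of "\<lambda>m. \<exists>l. m = Some (q, l, x)" for x] out[of "\<lambda>m. \<exists>l x. m = Some (q, l, x)"]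
      by simp
    then have "deliver P p U' j = deliver P p U j" if "j < p" for j
      using eq[OF that] by (simp add: deliver_def split: instr.split)
    then have "T0 = T \<and> (\<forall>j<p. v' j = v j)"
      using round.IH[OF round(5) round.prems(2)] by simp
    then show ?thesis using round(1) 1 2 by simp
  qed
qed

end

theory Submission
  imports Defs
begin

text \<open>
  Every PE scans its local input once.  It checks that the asserted output is defined on all local
  keys and not beaten by a local value, and it counts the distinct keys that the certificate
  assigns to it and whose asserted value it holds.  Comparing this count with the difference of two
  offsets tells whether all keys assigned to the PE are confirmed, without enumerating these keys,
  of which there may be far too many if the output is wrong.

  The local verdicts are combined by dissemination: in the rounds with distance
  \<open>d = 1, 2, 4, \<dots> < p\<close>, a PE \<open>j\<close> that knows of a reason to reject sends a message to PE
  \<open>(j + d) mod p\<close>, and all others are silent.  After these at most \<open>\<lceil>log 2 p\<rceil>\<close> rounds, every PE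
  knows whether some PE rejects.  As the time bound has no term in \<open>\<beta>\<close>, the messages must be empty:
  the information lies in their presence.
\<close>

section \<open>Symbolic execution of local code with step bounds\<close>

fun execs :: "instr list \<Rightarrow> nat \<Rightarrow> ('k, 'v::linorder) pe \<Rightarrow> ('k, 'v) pe option" where
  "execs P 0 s = Some s"
| "execs P (Suc t) s = (if pc s < length P then Option.bind (exec (P ! pc s) s) (execs P t) else None)"

lemma execs_add: "execs P (t + t') s = Option.bind (execs P t s) (execs P t')"
proof (induction t arbitrary: s)
  case (Suc t)
  show ?case by (cases "exec (P ! pc s) s") (simp_all add: Suc)
qed simp

lemma execs_local_run:
  assumes "execs P t s = Some s'" "pc s' < length P" "exec (P ! pc s') s' = None"
  shows "local_run P s t s'"
  using assms
proof (induction t arbitrary: s)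
  case 0
  then show ?case by (auto intro: local_run.stop)
next
  case (Suc t)
  then show ?case
    by (cases "exec (P ! pc s) s") (auto intro: local_run.step split: if_splits)
qed

text \<open>Only a bound on the number of steps is kept, because the branches of the code differ in
  length. Such bounds add up under composition.\<close>

definition reaches ::
    "instr list \<Rightarrow> ('k, 'v::linorder) pe \<Rightarrow> nat \<Rightarrow> (('k, 'v) pe \<Rightarrow> bool) \<Rightarrow> bool" where
  "reaches P s N Q \<longleftrightarrow> (\<exists>t s'. t \<le> N \<and> execs P t s = Some s' \<and> Q s')"

lemma reachesI: "execs P t s = Some s' \<Longrightarrow> t \<le> N \<Longrightarrow> Q s' \<Longrightarrow> reaches P s N Q"
  by (auto simp: reaches_def)

lemma reaches_exec:
  "t \<le> N \<Longrightarrow> (case execs P t s of None \<Rightarrow> False | Some s' \<Rightarrow> Q s') \<Longrightarrow> reaches P s N Q"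
  by (auto simp: reaches_def split: option.splits)

lemma reaches_mono: "reaches P s N Q \<Longrightarrow> N \<le> M \<Longrightarrow> reaches P s M Q"
  unfolding reaches_def using le_trans by blast

lemma reaches_bind:
  assumes "reaches P s N Q" "\<And>s'. Q s' \<Longrightarrow> reaches P s' M R"
  shows "reaches P s (N + M) R"
proof -
  obtain t s' where 1: "t \<le> N" "execs P t s = Some s'" "Q s'"
    using assms(1) by (auto simp: reaches_def)
  obtain t' s'' where 2: "t' \<le> M" "execs P t' s' = Some s''" "R s''"
    using assms(2)[OF 1(3)] by (auto simp: reaches_def)
  show ?thesis
    by (rule reachesI[of _ "t + t'" _ s'']) (use 1 2 in \<open>auto simp: execs_add\<close>)
qed

lemma reaches_execs:
  assumes "execs P t s = Some s'" "reaches P s' M R"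
  shows "reaches P s (t + M) R"
  using reaches_bind[OF reachesI[OF assms(1), of t "\<lambda>u. u = s'"]] assms(2) by simp

lemma reaches_local_run:
  assumes "reaches P s N Q" "\<And>s'. Q s' \<Longrightarrow> pc s' < length P \<and> exec (P ! pc s') s' = None"
  shows "\<exists>t s'. t \<le> N \<and> local_run P s t s' \<and> Q s'"
  using assms unfolding reaches_def by (metis execs_local_run)

section \<open>The checking program\<close>

text \<open>
  Registers 3 to 5 hold the position in the local input, the number of confirmed keys and the
  constant 1; 6 to 9 the current key, its value, the asserted value and the PE named by the
  certificate; 10 and 11 are scratch; 13 to 15 the distance, destination and incoming message of the current round.
  Register 12 is \<^const>\<open>Undef\<close> as long as no reason to reject is known and \<^term>\<open>Num 0\<close> afterwards.
  Register 16 is never written: it provides \<^const>\<open>Undef\<close>, as well as the number 0 for the content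
  and length of messages.  A confirmed key is erased from the certificate table, so that it is
  counted only once.
\<close>

definition checker :: "bool \<Rightarrow> instr list" where
  "checker b =
   [Const 3 0,
    Const 4 0,
    Const 5 1,
    Jump_Eq 3 2 17,      \<comment> \<open>3: scan the local input\<close>
    Load 6 0 3,
    Load 7 1 3,
    Load 8 2 6,
    Jump_Eq 8 16 22,
    (if b then Jump_Less 7 8 22 else Jump_Less 8 7 22),
    (if b then Jump_Less 8 7 15 else Jump_Less 7 8 15),
    Load 9 3 6,
    Jump_Eq 9 1 13,
    Jump 15,
    Store 3 6 16,
    Add 4 4 5,
    Add 3 3 5,
    Jump 3,
    Load 10 5 1,         \<comment> \<open>17: compare the count with the number of keys assigned to this PE\<close>
    Add 11 1 5,
    Load 11 5 11,
    Sub 11 11 10,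
    Jump_Eq 11 4 23,
    Const 12 0,          \<comment> \<open>22: reject\<close>
    Const 13 1,
    Jump_Less 13 0 27,   \<comment> \<open>24: communication rounds\<close>
    Jump_Eq 12 16 37,
    Halt False,
    Move 14 0,
    Jump_Eq 12 16 32,
    Add 14 1 13,
    Jump_Less 14 0 32,
    Sub 14 14 0,
    Exchange 14 16 16 15,
    Add 13 13 13,
    Jump_Eq 15 16 24,
    Move 12 15,
    Jump 24,
    Halt True]"

lemma length_checker: "length (checker b) = 38"
  by (simp add: checker_def)

text \<open>Addresses 1 and 2 are written with \<open>Suc\<close> because the program counter
  reaches them from 0. From a numeral address, simp turns the successor into the next
  numeral.\<close>

lemma checker_nth:
  "checker b ! 0 = Const 3 0"
  "checker b ! Suc 0 = Const 4 0"
  "checker b ! Suc (Suc 0) = Const 5 1"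
  "checker b ! 3 = Jump_Eq 3 2 17"
  "checker b ! 4 = Load 6 0 3"
  "checker b ! 5 = Load 7 1 3"
  "checker b ! 6 = Load 8 2 6"
  "checker b ! 7 = Jump_Eq 8 16 22"
  "checker b ! 8 = (if b then Jump_Less 7 8 22 else Jump_Less 8 7 22)"
  "checker b ! 9 = (if b then Jump_Less 8 7 15 else Jump_Less 7 8 15)"
  "checker b ! 10 = Load 9 3 6"
  "checker b ! 11 = Jump_Eq 9 1 13"
  "checker b ! 12 = Jump 15"
  "checker b ! 13 = Store 3 6 16"
  "checker b ! 14 = Add 4 4 5"
  "checker b ! 15 = Add 3 3 5"
  "checker b ! 16 = Jump 3"
  "checker b ! 17 = Load 10 5 1"
  "checker b ! 18 = Add 11 1 5"
  "checker b ! 19 = Load 11 5 11"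
  "checker b ! 20 = Sub 11 11 10"
  "checker b ! 21 = Jump_Eq 11 4 23"
  "checker b ! 22 = Const 12 0"
  "checker b ! 23 = Const 13 1"
  "checker b ! 24 = Jump_Less 13 0 27"
  "checker b ! 25 = Jump_Eq 12 16 37"
  "checker b ! 26 = Halt False"
  "checker b ! 27 = Move 14 0"
  "checker b ! 28 = Jump_Eq 12 16 32"
  "checker b ! 29 = Add 14 1 13"
  "checker b ! 30 = Jump_Less 14 0 32"
  "checker b ! 31 = Sub 14 14 0"
  "checker b ! 32 = Exchange 14 16 16 15"
  "checker b ! 33 = Add 13 13 13"
  "checker b ! 34 = Jump_Eq 15 16 24"
  "checker b ! 35 = Move 12 15"
  "checker b ! 36 = Jump 24"
  "checker b ! 37 = Halt True"
  by (simp_all add: checker_def)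

lemmas exec_simps = length_checker checker_nth set_reg_def jump_if_def

text \<open>Lets simp run the program for a concrete number of steps, one instruction per
  unfolding.\<close>

lemma execs_numeral:
  "execs P (numeral n) s =
    (if pc s < length P then Option.bind (exec (P ! pc s) s) (execs P (pred_numeral n)) else None)"
  by (simp add: numeral_eq_Suc)

section \<open>The scan of the local input\<close>

definition ready :: "nat \<Rightarrow> nat \<Rightarrow> nat \<Rightarrow> bool \<Rightarrow> ('k, 'v) pe \<Rightarrow> bool" where
  "ready p j d f s \<longleftrightarrow> pc s = 24 \<and> reg s 0 = Num p \<and> reg s (Suc 0) = Num j \<and> reg s 13 = Num d \<and>
    reg s 12 = (if f then Num 0 else Undef) \<and> reg s 16 = Undef"

definition beats :: "bool \<Rightarrow> 'v::linorder \<Rightarrow> 'v \<Rightarrow> bool" where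
  "beats b v w \<longleftrightarrow> (if b then v < w else w < v)"

text \<open>The map \<open>m\<close> stands for the current content of the certificate table, from
  which counted keys have been erased; it starts out as the certificate.\<close>

definition confirmed :: "('k \<rightharpoonup> 'v) \<Rightarrow> ('k \<rightharpoonup> nat) \<Rightarrow> nat \<Rightarrow> ('k \<times> 'v) list \<Rightarrow> 'k set" where
  "confirmed out m j zs = {k. m k = Some j \<and> (\<exists>v. out k = Some v \<and> (k, v) \<in> set zs)}"

definition unbeaten :: "bool \<Rightarrow> ('k \<rightharpoonup> 'v::linorder) \<Rightarrow> ('k \<times> 'v) list \<Rightarrow> bool" where
  "unbeaten b out zs \<longleftrightarrow> (\<forall>(k, v) \<in> set zs. \<exists>w. out k = Some w \<and> \<not> beats b v w)"

lemma finite_confirmed: "finite (confirmed out m j zs)"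
  by (rule finite_subset[of _ "fst ` set zs"]) (force simp: confirmed_def)+

lemma confirmed_Cons_other:
  "\<not> (m k = Some j \<and> out k = Some v) \<Longrightarrow> confirmed out m j ((k, v) # zs) = confirmed out m j zs"
  by (auto simp: confirmed_def)

text \<open>Erasing \<open>k\<close> keeps later copies of the same pair from being counted again,
  so the counter counts distinct keys.\<close>

lemma card_confirmed_Cons:
  assumes "m k = Some j" "out k = Some v"
  shows "card (confirmed out m j ((k, v) # zs)) = Suc (card (confirmed out (m(k := None)) j zs))"
proof -
  have "confirmed out m j ((k, v) # zs) = insert k (confirmed out (m(k := None)) j zs)"
    using assms by (auto simp: confirmed_def)
  moreover have "k \<notin> confirmed out (m(k := None)) j zs"
    by (simp add: confirmed_def)
  ultimately show ?thesis
    using finite_confirmed by (metis card_insert_disjoint)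
qed

lemma table_cell_erase: "(table_cell f m)(Key k := Undef) = table_cell f (m(k := None))"
  by (auto simp: table_cell_def fun_eq_iff split: cell.split)

text \<open>Induction on the unread input. While nothing is rejected, \<open>c\<close> plus the
  number of keys confirmable in the unread part under the current table \<open>m\<close> stays
  constant; the offsets belong to the fixed \<open>cert\<close>. The longest iteration takes 13
  instructions, and leaving the loop, by exhaustion or rejection, takes at most 8.\<close>

lemma scan:
  fixes zs :: "('k \<times> 'v::linorder) list"
  assumes "reg s 0 = Num p" "reg s (Suc 0) = Num j" "reg s 2 = Num (length zs)" "reg s 3 = Num i"
    "reg s 4 = Num c" "reg s 5 = Num (Suc 0)" "reg s 12 = Undef" "reg s 16 = Undef"
    "arr s 0 = input_cell (\<lambda>z. Key (fst z)) zs" "arr s (Suc 0) = input_cell (\<lambda>z. Val (snd z)) zs"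
    "arr s 2 = table_cell Val out" "arr s 3 = table_cell Num m" "arr s 5 = offset_cell p cert"
    "pc s = 3" "j < p" "i \<le> length zs"
  shows "reaches (checker b) s (14 * (length zs - i) + 10)
    (ready p j (Suc 0) (\<not> (unbeaten b out (drop i zs) \<and>
      c + card (confirmed out m j (drop i zs)) = offset cert (Suc j) - offset cert j)))"
  using assms
proof (induction "length zs - i" arbitrary: i c m s)
  case 0
  then have [simp]: "i = length zs" by simp
  have o: "arr s 5 (Num j) = Num (offset cert j)" "arr s 5 (Num (Suc j)) = Num (offset cert (Suc j))"
    using 0 by (auto simp: offset_cell_def)
  note sims = 0(2-9,15) o exec_simps execs_numeral
  show ?case
  proof (cases "c = offset cert (Suc j) - offset cert j")
    case True
    show ?thesis
      by (rule reaches_exec[of 7]) (use True in \<open>simp_all add: sims ready_def unbeaten_def confirmed_def\<close>)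
  next
    case False
    show ?thesis
      by (rule reaches_exec[of 8]) (use False in \<open>simp_all add: sims ready_def unbeaten_def confirmed_def\<close>)
  qed
next
  case (Suc n)
  note s = Suc.prems
  have i: "i < length zs" using Suc.hyps(2) by simp
  obtain k v where z: "zs ! i = (k, v)" by fastforce
  have d: "drop i zs = (k, v) # drop (Suc i) zs"
    using i z by (metis Cons_nth_drop_Suc)
  have sim: "arr s 0 (Num i) = Key k" "arr s (Suc 0) (Num i) = Val v"
    using s z i by (auto simp: input_cell_def)
  have m: "table_cell Num m (Key k) = (Num j :: ('k, 'v) cell) \<longleftrightarrow> m k = Some j"
    by (auto simp: table_cell_def split: option.split)
  note sims = s(1-8,11-14) sim less_imp_neq[OF i] exec_simps execs_numeral
  \<comment> \<open>Covers every iteration that continues the loop: at most 14 steps that keep both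
    parts of the verdict unchanged.\<close>
  have next_step: "reaches (checker b) s (14 * (length zs - i) + 10)
      (ready p j (Suc 0) (\<not> (unbeaten b out (drop i zs) \<and>
        c + card (confirmed out m j (drop i zs)) = offset cert (Suc j) - offset cert j)))"
    if "execs (checker b) t s = Some s'" "t \<le> 14"
      "reaches (checker b) s' (14 * (length zs - Suc i) + 10)
        (ready p j (Suc 0) (\<not> (unbeaten b out (drop (Suc i) zs) \<and>
          c' + card (confirmed out m' j (drop (Suc i) zs)) = offset cert (Suc j) - offset cert j)))"
      "unbeaten b out (drop i zs) = unbeaten b out (drop (Suc i) zs)"
      "c' + card (confirmed out m' j (drop (Suc i) zs)) = c + card (confirmed out m j (drop i zs))"
    for t s' c' m'
    using reaches_mono[OF reaches_execs[OF that(1,3)], of "14 * (length zs - i) + 10"] that(2,4,5) i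
    by (simp add: Suc_diff_Suc[symmetric])
  show ?case
  proof (cases "out k")
    case None
    then have "table_cell Val out (Key k) = Undef"
      by (simp add: table_cell_def)
    then show ?thesis
      by (intro reaches_exec[of 7]) (use None d in \<open>simp_all add: sims ready_def unbeaten_def\<close>)
  next
    case (Some w)
    then have w: "table_cell Val out (Key k) = Val w"
      by (simp add: table_cell_def)
    \<comment> \<open>These are the paths through the loop body once an asserted value exists:
      reject, skip a value worse than the asserted one, skip a match that is not to be counted, and
      count a match.\<close>
    consider "beats b v w" | "beats b w v" | "v = w" "m k \<noteq> Some j" | "v = w" "m k = Some j"
      by (cases v w rule: linorder_cases; cases b) (auto simp: beats_def)
    then show ?thesis
    proof cases
      case 1
      then show ?thesis
        by (intro reaches_exec[of 8], simp)
          (use Some d in \<open>cases b; simp add: sims w ready_def unbeaten_def beats_def\<close>)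
    next
      case 2
      then have "\<not> beats b v w" "v \<noteq> w"
        by (auto simp: beats_def split: if_splits)
      define s' where "s' = s\<lparr>reg := (reg s)(6 := Key k, 7 := Val v, 8 := Val w, 3 := Num (Suc i))\<rparr>"
      show ?thesis
      proof (rule next_step[of 9 s' c m])
        show "execs (checker b) 9 s = Some s'"
          using 2 by (cases b) (simp_all add: sims w beats_def s'_def)
        show "reaches (checker b) s' (14 * (length zs - Suc i) + 10)
          (ready p j (Suc 0) (\<not> (unbeaten b out (drop (Suc i) zs) \<and>
            c + card (confirmed out m j (drop (Suc i) zs)) = offset cert (Suc j) - offset cert j)))"
          by (rule Suc.hyps(1)) (use s i Suc.hyps(2) in \<open>auto simp: s'_def\<close>)
      qed (use \<open>\<not> beats b v w\<close> \<open>v \<noteq> w\<close> Some in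
          \<open>auto simp: d unbeaten_def confirmed_Cons_other\<close>)
    next
      case 3
      then have "\<not> beats b v w"
        by (auto simp: beats_def)
      define s' where "s' = s\<lparr>reg := (reg s)(6 := Key k, 7 := Val v, 8 := Val w,
        9 := table_cell Num m (Key k), 3 := Num (Suc i))\<rparr>"
      show ?thesis
      proof (rule next_step[of 12 s' c m])
        show "execs (checker b) 12 s = Some s'"
          using 3 by (simp add: sims w m s'_def)
        show "reaches (checker b) s' (14 * (length zs - Suc i) + 10)
          (ready p j (Suc 0) (\<not> (unbeaten b out (drop (Suc i) zs) \<and>
            c + card (confirmed out m j (drop (Suc i) zs)) = offset cert (Suc j) - offset cert j)))"
          by (rule Suc.hyps(1)) (use s i Suc.hyps(2) in \<open>auto simp: s'_def\<close>)
      qed (use \<open>\<not> beats b v w\<close> 3 Some in \<open>auto simp: d unbeaten_def confirmed_Cons_other\<close>)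
    next
      case 4
      then have "\<not> beats b v w"
        by (auto simp: beats_def)
      define s' where "s' = s\<lparr>reg := (reg s)(6 := Key k, 7 := Val v, 8 := Val w,
          9 := Num j, 4 := Num (Suc c), 3 := Num (Suc i)),
        arr := (arr s)(3 := table_cell Num (m(k := None)))\<rparr>"
      show ?thesis
      proof (rule next_step[of 13 s' "Suc c" "m(k := None)"])
        show "execs (checker b) 13 s = Some s'"
          using 4 m by (simp add: sims w s'_def table_cell_erase)
        show "reaches (checker b) s' (14 * (length zs - Suc i) + 10)
          (ready p j (Suc 0) (\<not> (unbeaten b out (drop (Suc i) zs) \<and>
            Suc c + card (confirmed out (m(k := None)) j (drop (Suc i) zs)) =
              offset cert (Suc j) - offset cert j)))"
          by (rule Suc.hyps(1)) (use s i Suc.hyps(2) in \<open>auto simp: s'_def\<close>)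
      qed (use \<open>\<not> beats b v w\<close> 4 Some in \<open>auto simp: d unbeaten_def card_confirmed_Cons\<close>)
    qed
  qed
qed

section \<open>Communication rounds and dissemination of rejections\<close>

definition sending :: "nat \<Rightarrow> nat \<Rightarrow> nat \<Rightarrow> bool \<Rightarrow> ('k, 'v) pe \<Rightarrow> bool" where
  "sending p j d f s \<longleftrightarrow> pc s = 32 \<and> reg s 0 = Num p \<and> reg s (Suc 0) = Num j \<and> reg s 13 = Num d \<and>
    reg s 12 = (if f then Num 0 else Undef) \<and> reg s 16 = Undef \<and>
    reg s 14 = Num (if f then (j + d) mod p else p)"

lemma ready_sending:
  assumes "ready p j d f s" "d < p" "j < p"
  shows "reaches (checker b) s 6 (sending p j d f)"
proof -
  note s = assms(1)[unfolded ready_def]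
  show ?thesis
  proof (cases f)
    case False
    show ?thesis
      by (rule reaches_exec[of 3])
        (use False s assms(2) in \<open>simp_all add: exec_simps execs_numeral sending_def\<close>)
  next
    case True
    show ?thesis
    proof (cases "j + d < p")
      case less: True
      show ?thesis
        by (rule reaches_exec[of 5])
          (use True less s assms(2) in \<open>simp_all add: exec_simps execs_numeral sending_def\<close>)
    next
      case False
      \<comment> \<open>As \<open>j\<close> and \<open>d\<close> are both below \<open>p\<close>, a
        single subtraction reduces the sum modulo \<open>p\<close>.\<close>
      then have "(j + d) mod p = j + d - p"
        using assms by (simp add: mod_if)
      then show ?thesis
        by (intro reaches_exec[of 6])
          (use True False s assms(2) in \<open>simp_all add: exec_simps execs_numeral sending_def\<close>)
    qed
  qed
qed

lemma ready_halt:
  assumes "ready p j d f s" "p \<le> d"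
  shows "reaches (checker b) s 2 (\<lambda>s. pc s = (if f then 26 else 37))"
  by (rule reaches_exec[of 2], simp)
    (use assms in \<open>cases f; simp add: exec_simps execs_numeral ready_def\<close>)

text \<open>The destination \<open>p\<close> is not the number of a PE and hence means silence.
  Register 16 holds \<open>Undef\<close>, which \<open>num\<close> reads as 0, so a message that is
  sent has length and content 0.\<close>

lemma outgoing_sending:
  assumes "sending p j d f s" "j < p"
  shows "outgoing (checker b) p s = (if f then Some ((j + d) mod p, 0, 0) else None)"
  using assms by (simp add: outgoing_def sending_def exec_simps)

text \<open>An empty message arrives as \<open>Num 0\<close>, the very cell that marks a known
  reason to reject, so copying it into register 12 suffices.\<close>

lemma received_ready:
  assumes "sending p j d f s"
  shows "reaches (checker b) (set_reg 15 (if g then Num 0 else Undef) s) 4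
    (ready p j (2 * d) (f \<or> g))"
proof (cases g)
  case True
  show ?thesis
    by (rule reaches_exec[of 4])
      (use assms True in \<open>simp_all add: exec_simps execs_numeral ready_def sending_def\<close>)
next
  case False
  show ?thesis
    by (rule reaches_exec[of 2])
      (use assms False in \<open>simp_all add: exec_simps execs_numeral ready_def sending_def\<close>)
qed

text \<open>Yields single-portedness: two senders of a round cannot share a destination, as
  otherwise \<open>p\<close> would divide a positive difference below \<open>p\<close>.\<close>

lemma shift_inj:
  fixes i j d p :: nat
  assumes "i < p" "j < p" "(i + d) mod p = (j + d) mod p"
  shows "i = j"
  using assms
proof (induction i j rule: linorder_wlog)
  case (le i j)
  then have "p dvd (j + d) - (i + d)"
    by (subst mod_eq_dvd_iff_nat[symmetric]) auto
  then show ?case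
    using le by (auto dest: dvd_imp_le)
qed simp

lemma deliver_sending:
  assumes "\<forall>j<p. sending p j d (f j) (S j)"
  shows "single_ported (checker b) p S" "max_message_length (checker b) p S = 0"
    and "q < p \<Longrightarrow> deliver (checker b) p S q =
      set_reg 15 (if \<exists>j<p. f j \<and> (j + d) mod p = q then Num 0 else Undef) (S q)"
proof -
  have out: "outgoing (checker b) p (S j) = Some (q, l, x) \<longleftrightarrow>
      f j \<and> (j + d) mod p = q \<and> l = 0 \<and> x = 0" if "j < p" for j q l x
    using outgoing_sending[of p j d "f j" "S j" b] assms that by auto
  show "single_ported (checker b) p S"
    unfolding single_ported_def using out by (metis shift_inj)
  have "insert 0 {l. \<exists>i<p. \<exists>q x. outgoing (checker b) p (S i) = Some (q, l, x)} = {0}"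
    using out by auto
  then show "max_message_length (checker b) p S = 0"
    by (simp only: max_message_length_def Max_singleton)
  have "incoming (checker b) p S q = (if \<exists>j<p. f j \<and> (j + d) mod p = q then Num 0 else Undef)" for q
  proof -
    have 1: "(\<exists>i<p. \<exists>l x. outgoing (checker b) p (S i) = Some (q, l, x)) \<longleftrightarrow>
        (\<exists>j<p. f j \<and> (j + d) mod p = q)"
      by (simp add: out cong: conj_cong)
    \<comment> \<open>All contents are 0, which determines the value of \<open>THE\<close> in
      \<open>incoming\<close>.\<close>
    have 2: "(\<exists>i<p. \<exists>l. outgoing (checker b) p (S i) = Some (q, l, x)) \<longleftrightarrow>
        (\<exists>j<p. f j \<and> (j + d) mod p = q) \<and> x = 0" for x
      by (simp add: out cong: conj_cong) blast
    show ?thesis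
      unfolding incoming_def 1 2 by (simp only: simp_thms the_eq_trivial cong: if_cong)
  qed
  then show "deliver (checker b) p S q =
      set_reg 15 (if \<exists>j<p. f j \<and> (j + d) mod p = q then Num 0 else Undef) (S q)" if "q < p"
    using assms that by (simp add: deliver_def sending_def exec_simps)
qed

text \<open>The invariant of dissemination: before the round with distance \<open>d\<close>, a PE
  knows exactly about the bad PEs fewer than \<open>d\<close> positions behind it on the ring,
  itself included.\<close>

definition informed :: "nat \<Rightarrow> (nat \<Rightarrow> bool) \<Rightarrow> nat \<Rightarrow> nat \<Rightarrow> bool" where
  "informed p bad d j \<longleftrightarrow> (\<exists>i<p. \<exists>e<d. bad i \<and> (i + e) mod p = j)"

lemma informed_all:
  fixes p d :: nat
  assumes "p \<le> d" "j < p"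
  shows "informed p bad d j \<longleftrightarrow> (\<exists>i<p. bad i)"
proof
  assume "\<exists>i<p. bad i"
  then obtain i where i: "i < p" "bad i" by auto
  \<comment> \<open>The cyclic distance from \<open>i\<close> to \<open>j\<close>; adding
    \<open>p\<close> first avoids truncated subtraction.\<close>
  have "(i + (j + p - i) mod p) mod p = (i + (j + p - i)) mod p"
    by (simp add: mod_simps)
  also have "\<dots> = j"
    using i assms by simp
  finally have "(i + (j + p - i) mod p) mod p = j" .
  moreover have "(j + p - i) mod p < d"
    using assms by (intro less_le_trans[OF mod_less_divisor]) auto
  ultimately show "informed p bad d j"
    using i by (auto simp: informed_def)
qed (auto simp: informed_def)

text \<open>A distance below \<open>2 * d\<close> is either below \<open>d\<close> already or
  becomes so after removing one hop of length \<open>d\<close>.\<close>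

lemma informed_double:
  fixes p d :: nat
  assumes "j < p"
  shows "informed p bad d j \<or> (\<exists>k<p. informed p bad d k \<and> (k + d) mod p = j) \<longleftrightarrow>
    informed p bad (2 * d) j"
proof
  assume "informed p bad d j \<or> (\<exists>k<p. informed p bad d k \<and> (k + d) mod p = j)"
  then show "informed p bad (2 * d) j"
  proof
    assume "informed p bad d j"
    then show ?thesis
      unfolding informed_def by (metis less_le_trans mult_2 le_add1)
  next
    assume "\<exists>k<p. informed p bad d k \<and> (k + d) mod p = j"
    then obtain i e where "i < p" "e < d" "bad i" "((i + e) mod p + d) mod p = j"
      unfolding informed_def by auto
    then have "e + d < 2 * d" "(i + (e + d)) mod p = j"
      by (simp_all add: mod_simps add.assoc)
    with \<open>i < p\<close> \<open>bad i\<close> show ?thesis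
      unfolding informed_def by blast
  qed
next
  assume "informed p bad (2 * d) j"
  then obtain i e where i: "i < p" "e < 2 * d" "bad i" "(i + e) mod p = j"
    unfolding informed_def by auto
  show "informed p bad d j \<or> (\<exists>k<p. informed p bad d k \<and> (k + d) mod p = j)"
  proof (cases "e < d")
    case True
    with i show ?thesis unfolding informed_def by blast
  next
    case False
    let ?k = "(i + (e - d)) mod p"
    have "?k < p" "e - d < d"
      using i False by auto
    then have "?k < p" "informed p bad d ?k"
      using i unfolding informed_def by blast+
    moreover have "(?k + d) mod p = j"
      using i False by (simp add: mod_simps)
    ultimately show ?thesis by blast
  qed
qed

lemma reaches_local_runs:
  fixes p :: nat
  assumes "\<And>j. j < p \<Longrightarrow> reaches P (S j) N (Q j)" "0 < p"
    "\<And>j s. j < p \<Longrightarrow> Q j s \<Longrightarrow> pc s < length P \<and> exec (P ! pc s) s = None"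
  obtains t S' where "\<And>j. j < p \<Longrightarrow> local_run P (S j) (t j) (S' j)" "\<And>j. j < p \<Longrightarrow> Q j (S' j)"
    "Max (t ` {..<p}) \<le> N"
proof -
  have "\<forall>j. \<exists>t s. j < p \<longrightarrow> t \<le> N \<and> local_run P (S j) t s \<and> Q j s"
    using reaches_local_run[OF assms(1) assms(3)] by meson
  then obtain t S' where "\<And>j. j < p \<Longrightarrow> t j \<le> N \<and> local_run P (S j) (t j) (S' j) \<and> Q j (S' j)"
    by metis
  moreover from this have "Max (t ` {..<p}) \<le> N"
    using assms(2) by (subst Max_le_iff) auto
  ultimately show ?thesis using that by blast
qed

lemma disseminate_halt:
  assumes "0 < p" "p \<le> d"
    and "\<And>j. j < p \<Longrightarrow>
      reaches (checker b) (S j) B (ready p j d (informed p bad d j))"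
  shows "\<exists>T. run (checker b) p \<alpha> \<beta> S T (\<lambda>_. \<forall>i<p. \<not> bad i) \<and> T \<le> real B + 2"
proof -
  have 1: "reaches (checker b) (S j) (B + 2) (\<lambda>s. pc s = (if \<exists>i<p. bad i then 26 else 37))"
    if "j < p" for j
    using reaches_bind[OF assms(3)[OF that] ready_halt[OF _ assms(2)]]
    by (simp only: informed_all[OF assms(2) that])
  obtain t S' where t: "\<And>j. j < p \<Longrightarrow> local_run (checker b) (S j) (t j) (S' j)"
      "\<And>j. j < p \<Longrightarrow> pc (S' j) = (if \<exists>i<p. bad i then 26 else 37)" "Max (t ` {..<p}) \<le> B + 2"
    by (rule reaches_local_runs[OF 1 assms(1)]) (auto simp: exec_simps split: if_splits)
  have "run (checker b) p \<alpha> \<beta> S (real (Max (t ` {..<p}))) (\<lambda>_. \<forall>i<p. \<not> bad i)"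
    by (rule run.halt[OF t(1)]) (auto simp: t(2) exec_simps)
  with t(3) show ?thesis by force
qed

text \<open>Induction on the round budget \<open>r\<close>, doubling \<open>d\<close>.
  \<open>B\<close> bounds the local work pending before the loop head is reached. Each round costs
  at most 6 instructions before the exchange and 4 after it; the latter fall into the next phase and
  become its \<open>B\<close>.\<close>

lemma disseminate:
  fixes S :: "nat \<Rightarrow> ('k, 'v::linorder) pe"
  assumes "0 < p" "0 \<le> \<alpha>" "p \<le> d * 2 ^ r"
    and "\<And>j. j < p \<Longrightarrow>
      reaches (checker b) (S j) B (ready p j d (informed p bad d j))"
  shows "\<exists>T. run (checker b) p \<alpha> \<beta> S T (\<lambda>_. \<forall>i<p. \<not> bad i) \<and> T \<le> real B + 2 + real r * (\<alpha> + 10)"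
  using assms(3,4)
proof (induction r arbitrary: d S B)
  case 0
  then have "p \<le> d" by simp
  from disseminate_halt[OF assms(1) this 0(2)] show ?case by simp
next
  case (Suc r)
  show ?case
  proof (cases "p \<le> d")
    \<comment> \<open>The budget \<open>r\<close> is only an upper bound: the loop may end before it
      is used up.\<close>
    case True
    have "0 \<le> real (Suc r) * (\<alpha> + 10)"
      using assms(2) by simp
    then show ?thesis
      using disseminate_halt[OF assms(1) True Suc.prems(2), of \<alpha> \<beta>] by force
  next
    case False
    then have 1: "reaches (checker b) (S j) (B + 6) (sending p j d (informed p bad d j))" if "j < p" for j
      by (intro reaches_bind[OF Suc.prems(2)[OF that]] ready_sending) (use that in auto)
    obtain t S' where t: "\<And>j. j < p \<Longrightarrow> local_run (checker b) (S j) (t j) (S' j)"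
        "\<And>j. j < p \<Longrightarrow> sending p j d (informed p bad d j) (S' j)" "Max (t ` {..<p}) \<le> B + 6"
      by (rule reaches_local_runs[OF 1 assms(1)]) (auto simp: exec_simps sending_def)
    have "\<forall>j<p. sending p j d (informed p bad d j) (S' j)"
      using t(2) by blast
    note deliver = deliver_sending[where b = b, OF this]
    have "reaches (checker b) (deliver (checker b) p S' j) 4 (ready p j (2 * d) (informed p bad (2 * d) j))"
      if "j < p" for j
      unfolding deliver(3)[OF that] informed_double[OF that, symmetric]
      by (rule received_ready[OF t(2)[OF that]])
    moreover have "p \<le> 2 * d * 2 ^ r"
      using Suc.prems(1) by (simp add: mult.assoc mult.left_commute)
    ultimately obtain T where T: "run (checker b) p \<alpha> \<beta> (deliver (checker b) p S') T (\<lambda>_. \<forall>i<p. \<not> bad i)"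
        "T \<le> real 4 + 2 + real r * (\<alpha> + 10)"
      using Suc.IH[of "2 * d" "deliver (checker b) p S'" 4] by blast
    have "run (checker b) p \<alpha> \<beta> S (real (Max (t ` {..<p})) +
        (\<alpha> + \<beta> * real (max_message_length (checker b) p S')) + T) (\<lambda>_. \<forall>i<p. \<not> bad i)"
      by (rule run.round[OF t(1) _ deliver(1) T(1)]) (use t(2) in \<open>auto simp: sending_def exec_simps\<close>)
    moreover have "real (Max (t ` {..<p})) \<le> real B + 6"
      using t(3) by linarith
    then have "real (Max (t ` {..<p})) + (\<alpha> + \<beta> * real (max_message_length (checker b) p S')) + T
        \<le> real B + 2 + real (Suc r) * (\<alpha> + 10)"
      using T(2) by (simp add: deliver(2) algebra_simps)
    ultimately show ?thesis by blast
  qed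
qed

section \<open>From the initial memory to the local verdict\<close>

lemma initial_ready:
  fixes xs :: "nat \<Rightarrow> ('k \<times> 'v::linorder) list"
  assumes "j < p"
  shows "reaches (checker b) (initial p xs out cert ks j) (14 * length (xs j) + 13)
    (ready p j (Suc 0) (\<not> (unbeaten b out (xs j) \<and>
      card (confirmed out cert j (xs j)) = offset cert (Suc j) - offset cert j)))"
proof -
  let ?s = "initial p xs out cert ks j"
  let ?s' = "?s\<lparr>pc := 3, reg := (reg ?s)(3 := Num 0, 4 := Num 0, 5 := Num (Suc 0))\<rparr>"
  have "execs (checker b) 3 ?s = Some ?s'"
    by (simp add: initial_def exec_simps execs_numeral)
  moreover have "reaches (checker b) ?s' (14 * (length (xs j) - 0) + 10)
    (ready p j (Suc 0) (\<not> (unbeaten b out (drop 0 (xs j)) \<and>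
      0 + card (confirmed out cert j (drop 0 (xs j))) = offset cert (Suc j) - offset cert j)))"
    by (rule scan) (use assms in \<open>simp_all add: initial_def\<close>)
  ultimately show ?thesis
    using reaches_execs reaches_mono by fastforce
qed

text \<open>The offset difference is the number of keys assigned to \<open>j\<close>. The confirmed
  keys form a subset of this finite set, so equal cardinality means equality.\<close>

lemma card_confirmed_iff:
  assumes "well_formed p out cert ks"
  shows "card (confirmed out cert j zs) = offset cert (Suc j) - offset cert j \<longleftrightarrow>
    (\<forall>k. cert k = Some j \<longrightarrow> (\<exists>v. out k = Some v \<and> (k, v) \<in> set zs))"
proof -
  let ?K = "{k. cert k = Some j}"
  have fin: "finite (dom cert)"
    using assms by (metis well_formed_def List.finite_set)
  then have fin': "finite ?K" "finite {k. \<exists>r<j. cert k = Some r}"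
    by (auto elim: finite_subset[rotated])
  have "{k. \<exists>r<Suc j. cert k = Some r} = {k. \<exists>r<j. cert k = Some r} \<union> ?K"
    by (auto simp: less_Suc_eq)
  then have "offset cert (Suc j) = offset cert j + card ?K"
    unfolding offset_def by (simp only:) (rule card_Un_disjoint, use fin' in auto)
  moreover have "confirmed out cert j zs \<subseteq> ?K"
    by (auto simp: confirmed_def)
  then have "card (confirmed out cert j zs) = card ?K \<longleftrightarrow> confirmed out cert j zs = ?K"
    using card_subset_eq[OF fin'(1)] by auto
  moreover have "confirmed out cert j zs = ?K \<longleftrightarrow>
      (\<forall>k. cert k = Some j \<longrightarrow> (\<exists>v. out k = Some v \<and> (k, v) \<in> set zs))"
    by (auto simp: confirmed_def)
  ultimately show ?thesis by simp
qed

section \<open>Local validity against the global aggregate\<close>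

lemma set_whole_input: "set (whole_input p xs) = (\<Union>j<p. set (xs j))"
  by (auto simp: whole_input_def)

definition selector :: "bool \<Rightarrow> 'v::linorder set \<Rightarrow> 'v" where
  "selector b = (if b then Min else Max)"

lemma selector_eqI:
  assumes "finite A" "w \<in> A" "\<And>v. v \<in> A \<Longrightarrow> \<not> beats b v w"
  shows "selector b A = w"
  using assms by (cases b) (auto simp: selector_def beats_def not_less intro: Min_eqI Max_eqI)

lemma selector_unbeaten:
  assumes "finite A" "v \<in> A"
  shows "\<not> beats b v (selector b A)"
  using assms by (cases b) (auto simp: selector_def beats_def not_less)

definition locally_valid ::
    "bool \<Rightarrow> ('k \<rightharpoonup> 'v::linorder) \<Rightarrow> ('k \<rightharpoonup> nat) \<Rightarrow> nat \<Rightarrow> ('k \<times> 'v) list \<Rightarrow> bool" where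
  "locally_valid b out cert j zs \<longleftrightarrow> unbeaten b out zs \<and>
    (\<forall>k. cert k = Some j \<longrightarrow> (\<exists>v. out k = Some v \<and> (k, v) \<in> set zs))"

lemma finite_values: "finite {v. (k, v) \<in> set zs}"
  by (rule finite_subset[of _ "snd ` set zs"]) force+

text \<open>The certificate need not be valid here. Well-formedness names some PE for each asserted
  key; that PE has found the asserted value in its own input, so the value is attained, and no PE
  holds a better one. Input keys missing from \<open>out\<close> are excluded by
  \<open>unbeaten\<close>.\<close>

lemma locally_valid_sound:
  assumes wf: "well_formed p out cert ks" and valid: "\<And>j. j < p \<Longrightarrow> locally_valid b out cert j (xs j)"
  shows "out = aggregate (selector b) (whole_input p xs)"
proof
  fix k
  have unbeaten: "\<exists>w. out k = Some w \<and> \<not> beats b v w" if "(k, v) \<in> set (whole_input p xs)" for v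
    using that valid by (fastforce simp: set_whole_input locally_valid_def unbeaten_def)
  show "out k = aggregate (selector b) (whole_input p xs) k"
  proof (cases "out k")
    case None
    then show ?thesis
      using unbeaten by (force simp: aggregate_def)
  next
    case (Some w)
    then obtain j where j: "cert k = Some j" "j < p"
      using wf by (fastforce simp: well_formed_def ran_def)
    then have "(k, w) \<in> set (whole_input p xs)"
      using valid Some by (fastforce simp: set_whole_input locally_valid_def)
    moreover from this have "selector b {v. (k, v) \<in> set (whole_input p xs)} = w"
      using unbeaten Some by (intro selector_eqI finite_values) auto
    ultimately show ?thesis
      using Some by (force simp: aggregate_def)
  qed
qed

lemma locally_valid_complete:
  assumes wf: "well_formed p out cert ks" and out: "out = aggregate (selector b) (whole_input p xs)"
    and cert: "valid_certificate (selector b) p xs cert" and "j < p"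
  shows "locally_valid b out cert j (xs j)"
  unfolding locally_valid_def
proof
  show "unbeaten b out (xs j)"
    unfolding unbeaten_def
  proof clarify
    fix k v assume "(k, v) \<in> set (xs j)"
    then have kv: "(k, v) \<in> set (whole_input p xs)"
      using \<open>j < p\<close> by (auto simp: set_whole_input)
    then have "out k = Some (selector b {v. (k, v) \<in> set (whole_input p xs)})"
      by (force simp: out aggregate_def)
    moreover have "\<not> beats b v (selector b {v. (k, v) \<in> set (whole_input p xs)})"
      using kv by (intro selector_unbeaten finite_values) auto
    ultimately show "\<exists>w. out k = Some w \<and> \<not> beats b v w" by blast
  qed
  show "\<forall>k. cert k = Some j \<longrightarrow> (\<exists>v. out k = Some v \<and> (k, v) \<in> set (xs j))"
  proof (intro allI impI)
    fix k assume k: "cert k = Some j"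
    \<comment> \<open>Well-formedness rules out certificate entries for keys without asserted value;
      validity then places that value at \<open>j\<close>.\<close>
    then obtain v where "out k = Some v"
      using wf by (metis well_formed_def domD domI)
    then show "\<exists>v. out k = Some v \<and> (k, v) \<in> set (xs j)"
      using cert k out by (fastforce simp: valid_certificate_def)
  qed
qed

section \<open>Number of rounds, time bound and conclusion\<close>

lemma rounds_bound:
  assumes "0 < p"
  obtains r where "p \<le> 2 ^ r" "real r \<le> 2 * log 2 (real p)"
proof (cases "p = 1")
  case True
  then show ?thesis using that[of 0] by simp
next
  case False
  then have p: "2 \<le> real p" using assms by simp
  then have log: "1 \<le> log 2 (real p)" by simp
  define r where "r = nat \<lceil>log 2 (real p)\<rceil>"
  have "log 2 (real p) \<le> real r"
    unfolding r_def by linarith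
  then have "real p \<le> 2 powr real r"
    using p by (simp add: log_le_iff)
  then have "p \<le> 2 ^ r"
    by (simp add: powr_realpow flip: of_nat_le_iff)
  \<comment> \<open>As the logarithm is at least 1 here, rounding it up at most doubles it.\<close>
  moreover have "real r \<le> 2 * log 2 (real p)"
    unfolding r_def using log by linarith
  ultimately show ?thesis using that by blast
qed

lemma checker_correct:
  fixes xs :: "nat \<Rightarrow> ('k \<times> 'v::linorder) list"
  assumes "0 < p" "1 \<le> \<alpha>" and n: "n = length (whole_input p xs)"
    and balanced: "\<And>j. j < p \<Longrightarrow> real (length (xs j)) \<le> C * (real n / real p)"
    and wf: "well_formed p out cert ks"
  shows "\<exists>T accept. run (checker b) p \<alpha> \<beta> (initial p xs out cert ks) T (\<lambda>_. accept) \<and>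
    (out = aggregate (selector b) (whole_input p xs) \<and>
      valid_certificate (selector b) p xs cert \<longrightarrow> accept) \<and>
    (out \<noteq> aggregate (selector b) (whole_input p xs) \<longrightarrow> \<not> accept) \<and>
    (0 < n \<longrightarrow> T \<le> (14 * \<bar>C\<bar> + 37) * (real n / real p + \<alpha> * log 2 (real p)))"
proof -
  let ?bad = "\<lambda>j. \<not> locally_valid b out cert j (xs j)"
  define M where "M = Max ((\<lambda>j. length (xs j)) ` {..<p})"
  have M: "length (xs j) \<le> M" if "j < p" for j
    unfolding M_def using that by (intro Max_ge) auto
  have "M \<in> (\<lambda>j. length (xs j)) ` {..<p}"
    unfolding M_def using \<open>0 < p\<close> by (intro Max_in) auto
  then have M_le: "real M \<le> C * (real n / real p)"
    using balanced by auto
  obtain r where r: "p \<le> 2 ^ r" "real r \<le> 2 * log 2 (real p)"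
    using rounds_bound[OF \<open>0 < p\<close>] .
  have "reaches (checker b) (initial p xs out cert ks j) (14 * M + 13)
      (ready p j (Suc 0) (informed p ?bad (Suc 0) j))" if "j < p" for j
  proof -
    \<comment> \<open>Before the first round, with distance 1, a PE knows only its own
      verdict.\<close>
    have "informed p ?bad (Suc 0) j \<longleftrightarrow> ?bad j"
      using that by (auto simp: informed_def)
    also have "\<dots> \<longleftrightarrow> \<not> (unbeaten b out (xs j) \<and>
        card (confirmed out cert j (xs j)) = offset cert (Suc j) - offset cert j)"
      by (simp add: locally_valid_def card_confirmed_iff[OF wf])
    finally have bad: "informed p ?bad (Suc 0) j \<longleftrightarrow> \<dots>" .
    show ?thesis
      unfolding bad by (rule reaches_mono[OF initial_ready[OF that]]) (simp add: M[OF that])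
  qed
  then obtain T where T: "run (checker b) p \<alpha> \<beta> (initial p xs out cert ks) T (\<lambda>_. \<forall>j<p. \<not> ?bad j)"
      "T \<le> real (14 * M + 13) + 2 + real r * (\<alpha> + 10)"
    using disseminate[of p \<alpha> "Suc 0" r b "initial p xs out cert ks" "14 * M + 13" ?bad \<beta>]
      \<open>0 < p\<close> \<open>1 \<le> \<alpha>\<close> r(1) by auto
  \<comment> \<open>The scan contributes \<open>14 * \<bar>C\<bar>\<close>; the constants 13 and 2
    contribute 15, and the rounds 22, which gives 37.\<close>
  have "T \<le> (14 * \<bar>C\<bar> + 37) * (real n / real p + \<alpha> * log 2 (real p))" if "0 < n"
  proof -
    define X where "X = real n / real p"
    define Y where "Y = \<alpha> * log 2 (real p)"
    have X: "0 \<le> X" by (simp add: X_def)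
    have log: "0 \<le> log 2 (real p)" using \<open>0 < p\<close> by simp
    then have Y: "0 \<le> Y" using \<open>1 \<le> \<alpha>\<close> by (simp add: Y_def)
    \<comment> \<open>Absorbs the additive constants. For one PE the logarithm vanishes and
      \<open>0 < n\<close> is needed; otherwise the logarithmic term is at least 1.\<close>
    have "1 \<le> X + Y"
    proof (cases "p = 1")
      case True
      then show ?thesis using that Y by (simp add: X_def)
    next
      case False
      then have "1 * 1 \<le> Y"
        unfolding Y_def using \<open>0 < p\<close> \<open>1 \<le> \<alpha>\<close> by (intro mult_mono) auto
      then show ?thesis using X by simp
    qed
    moreover have "real M \<le> \<bar>C\<bar> * X"
      using M_le X by (metis X_def abs_ge_self mult_right_mono order_trans)
    \<comment> \<open>Since \<open>\<alpha>\<close> is at least 1, the 10 local instructions per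
      round are absorbed into \<open>11 * \<alpha>\<close>.\<close>
    moreover have "real r * (\<alpha> + 10) \<le> (2 * log 2 (real p)) * (11 * \<alpha>)"
      using r(2) log \<open>1 \<le> \<alpha>\<close> by (intro mult_mono) auto
    then have "real r * (\<alpha> + 10) \<le> 22 * Y" by (simp add: Y_def mult.commute)
    moreover have "0 \<le> \<bar>C\<bar> * Y" using Y by simp
    ultimately have "T \<le> (14 * \<bar>C\<bar> + 37) * (X + Y)"
      using T(2) X by (simp add: algebra_simps)
    then show ?thesis by (simp add: X_def Y_def)
  qed
  moreover have "out = aggregate (selector b) (whole_input p xs)" if "\<forall>j<p. \<not> ?bad j"
    using locally_valid_sound[OF wf] that by blast
  moreover have "\<forall>j<p. \<not> ?bad j" if "out = aggregate (selector b) (whole_input p xs)"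
      "valid_certificate (selector b) p xs cert"
    using locally_valid_complete[OF wf that] by blast
  ultimately show ?thesis
    using T(1) by blast
qed

theorem theorem4:
  "\<forall>agg \<in> {Min, Max :: 'v::linorder set \<Rightarrow> 'v}.
     \<exists>P. \<forall>C::real. \<exists>c::real. \<forall>(p::nat) (\<alpha>::real) (\<beta>::real) (xs :: nat \<Rightarrow> ('k \<times> 'v) list) out cert ks n.
       0 < p \<longrightarrow> 1 \<le> \<alpha> \<longrightarrow> 0 \<le> \<beta> \<longrightarrow>
       n = length (whole_input p xs) \<longrightarrow>
       (\<forall>j<p. real (length (xs j)) \<le> C * (real n / real p)) \<longrightarrow>
       well_formed p out cert ks \<longrightarrow>
       (\<exists>T accept.
          run P p \<alpha> \<beta> (initial p xs out cert ks) T (\<lambda>_. accept) \<and>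
          (out = aggregate agg (whole_input p xs) \<and> valid_certificate agg p xs cert \<longrightarrow> accept) \<and>
          (out \<noteq> aggregate agg (whole_input p xs) \<longrightarrow> \<not> accept) \<and>
          (0 < n \<longrightarrow> T \<le> c * (real n / real p + \<alpha> * log 2 (real p))))"
proof
  fix agg :: "'v set \<Rightarrow> 'v"
  assume "agg \<in> {Min, Max}"
  then obtain b where agg: "agg = selector b"
    by (metis insert_iff selector_def singletonD)
  show "\<exists>P. \<forall>C::real. \<exists>c::real. \<forall>(p::nat) (\<alpha>::real) (\<beta>::real) (xs :: nat \<Rightarrow> ('k \<times> 'v) list) out cert ks n.
       0 < p \<longrightarrow> 1 \<le> \<alpha> \<longrightarrow> 0 \<le> \<beta> \<longrightarrow>
       n = length (whole_input p xs) \<longrightarrow>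
       (\<forall>j<p. real (length (xs j)) \<le> C * (real n / real p)) \<longrightarrow>
       well_formed p out cert ks \<longrightarrow>
       (\<exists>T accept.
          run P p \<alpha> \<beta> (initial p xs out cert ks) T (\<lambda>_. accept) \<and>
          (out = aggregate agg (whole_input p xs) \<and> valid_certificate agg p xs cert \<longrightarrow> accept) \<and>
          (out \<noteq> aggregate agg (whole_input p xs) \<longrightarrow> \<not> accept) \<and>
          (0 < n \<longrightarrow> T \<le> c * (real n / real p + \<alpha> * log 2 (real p))))"
    unfolding agg
    by (rule exI[of _ "checker b"], rule allI, rule_tac x = "14 * \<bar>C\<bar> + 37" in exI)
      (intro allI impI checker_correct; simp)
qed

end
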